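(* Let $n$ be a non-negative integer and let $a\in\mathbb{C}$ with $a\neq 0$. Let $x=u+au^{-1}$ with $u\in\mathbb{C}$, $u\neq 0$ and $u^2\neq a$. Then $$(x^2-4a)\,F_n''(x,a)+3x\,F_n'(x,a)-n^2\,F_n(x,a)=2n\,D_n(x,a),$$ where $F_n(x,a)$ is the $n$-th Dickson polynomial of the third kind, $D_n(x,a)$ is the $n$-th Dickson polynomial of the first kind, and primes denote derivatives with respect to $x$.
   Context: For a non-negative integer $n$ and a parameter $a\in\mathbb{C}$, the $n$-th Dickson polynomial of the first kind is $$D_n(x,a)=\sum_{i=0}^{\lfloor n/2\rfloor}\frac{n}{n-i}\binom{n-i}{i}(-a)^i x^{n-2i},$$ and the $n$-th Dickson polynomial of the third kind is $$F_n(x,a)=\sum_{i=0}^{\lfloor n/2\rfloor}\frac{n-2i}{n-i}\binom{n-i}{i}(-a)^i x^{n-2i}.$$ For $n=0$, where these formulas read $0/0$, the conventions are $D_0(x,a)=2$ and $F_0(x,a)=0$, consistent with the functional equations $D_n(u+a/u,a)=u^n+(a/u)^n$ and, for $u^2\neq a$, $F_n(u+a/u,a)=(u+a/u)\,\dfrac{u^n-(a/u)^n}{u-a/u}$. *)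

theory Defs
  imports Complex_Main "HOL-Computational_Algebra.Polynomial"
begin

text \<open>
  Dickson polynomials of the first and third kind in one indeterminate, with parameter
  \<open>a\<close>.  The summation bound \<open>i \<le> n div 2\<close> ensures that the natural-number subtractions
  \<open>n - i\<close> and \<open>n - 2 * i\<close> do not truncate.  For \<open>n = 0\<close> the closed formulas
  read \<open>0/0\<close>, so that case is set by convention to the values given by the functional equations.
\<close>

definition dickson_first :: "nat \<Rightarrow> complex \<Rightarrow> complex poly" where
  "dickson_first n a =
     (if n = 0 then [:2:]
      else \<Sum>i\<le>n div 2.
        monom (of_nat n / of_nat (n - i) * of_nat ((n - i) choose i) * (- a) ^ i) (n - 2 * i))"

definition dickson_third :: "nat \<Rightarrow> complex \<Rightarrow> complex poly" where
  "dickson_third n a =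
     (if n = 0 then 0
      else \<Sum>i\<le>n div 2.
        monom (of_nat (n - 2 * i) / of_nat (n - i) * of_nat ((n - i) choose i) * (- a) ^ i)
          (n - 2 * i))"

end

theory Submission
  imports Defs
begin

text \<open>
  Comparing coefficients, \<open>n F\<^sub>n = x D\<^sub>n'\<close>.  So the claim follows from the differential equation
  \<open>(x\<^sup>2 - 4 a) D\<^sub>n'' + x D\<^sub>n' = n\<^sup>2 D\<^sub>n\<close> together with its derivative, after cancelling \<open>n\<close>.
  Applied to a single monomial of \<open>D\<^sub>n\<close>, the operator of that equation gives a difference of
  consecutive terms of one sequence, so the sum over all monomials telescopes.
\<close>

text \<open>Both sides equal \<open>Suc N * (N - i) * (N choose i)\<close>, by the two absorption
  identities. With \<open>Suc N = n - i\<close>, this links the binomial coefficients of consecutive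
  Dickson terms.\<close>

lemma choose_shift_both:
  assumes "i \<le> Suc N"
  shows "Suc i * Suc N * (N choose Suc i) = (Suc N - i) * (N - i) * (Suc N choose i)"
proof -
  have absorb: "Suc i * (N choose Suc i) = (N - i) * (N choose i)"
    by (metis binomial_absorb_comp binomial_absorption mult.commute diff_Suc_Suc)
  have shift: "(Suc N - i) * (Suc N choose i) = Suc N * (N choose i)"
    using binomial_absorb_comp[of "Suc N" i] by simp
  have "Suc i * Suc N * (N choose Suc i) = Suc N * (Suc i * (N choose Suc i))"
    by (simp only: ac_simps)
  also have "\<dots> = (N - i) * (Suc N * (N choose i))"
    by (simp only: absorb ac_simps)
  also have "\<dots> = (Suc N - i) * (N - i) * (Suc N choose i)"
    by (simp only: shift[symmetric] ac_simps)
  finally show ?thesis .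
qed

lemma pderiv_sum: "pderiv (\<Sum>i\<in>I. f i) = (\<Sum>i\<in>I. pderiv (f i))"
  using higher_pderiv_sum[of 1] by simp

lemma smult_sum_right: "smult c (\<Sum>i\<in>I. f i) = (\<Sum>i\<in>I. smult c (f i))"
  by (induction I rule: infinite_finite_induct) (simp_all add: smult_add_right)

lemma X_mult_pderiv_monom:
  "[:0, 1:] * pderiv (monom c k) = monom (of_nat k * (c :: 'a :: idom)) k"
  by (cases k) (simp_all add: pderiv_monom flip: monom_Suc)

lemma X2_mult_pderiv2_monom:
  "[:0, 0, 1:] * pderiv (pderiv (monom c k)) = monom (of_nat k * (of_nat k - 1) * (c :: 'a :: idom)) k"
proof (cases "k < 2")
  case True
  then have "k = 0 \<or> k = 1" by auto
  then show ?thesis by (auto simp: pderiv_monom)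
next
  case False
  then obtain j where "k = Suc (Suc j)" by (metis less_2_cases_iff not0_implies_Suc One_nat_def)
  then show ?thesis by (simp add: pderiv_monom algebra_simps flip: monom_Suc)
qed

text \<open>Under x = u + a/u this is (u d/du)^2 - n^2, which annihilates both u^n and
  (a/u)^n.\<close>

definition dickson_op :: "nat \<Rightarrow> complex \<Rightarrow> complex poly \<Rightarrow> complex poly" where
  "dickson_op n a p =
     [:- 4 * a, 0, 1:] * pderiv (pderiv p) + [:0, 1:] * pderiv p - smult ((of_nat n)\<^sup>2) p"

lemma dickson_op_sum: "dickson_op n a (\<Sum>i\<in>I. f i) = (\<Sum>i\<in>I. dickson_op n a (f i))"
  by (simp only: dickson_op_def pderiv_sum smult_sum_right sum_distrib_left sum.distrib sum_subtractf)

text \<open>The Euler part x^2 p'' + x p' has the monomial as eigenvector, with eigenvalue k(k-1) +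
  k = k^2; only -4a p'' lowers the degree. For k < 2 the truncated exponent \<open>k - 2\<close> is
  harmless, since k(k-1) = 0.\<close>

lemma dickson_op_monom:
  "dickson_op n a (monom c k) =
     monom (((of_nat k)\<^sup>2 - (of_nat n)\<^sup>2) * c) k
     - monom (4 * a * (of_nat k * (of_nat k - 1)) * c) (k - 2)"
proof -
  have split: "[:- 4 * a, 0, 1:] = [:0, 0, 1:] - [:4 * a:]" by simp
  have low: "[:4 * a:] * pderiv (pderiv (monom c k)) =
      monom (4 * a * (of_nat k * (of_nat k - 1)) * c) (k - 2)"
    by (cases k) (simp_all add: pderiv_monom smult_monom algebra_simps numeral_2_eq_2)
  show ?thesis
    unfolding dickson_op_def split left_diff_distrib X2_mult_pderiv2_monom low X_mult_pderiv_monom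
    by (simp add: poly_eq_iff algebra_simps power2_eq_square)
qed

text \<open>The degree-preserving part yields \<open>- B i\<close>, and the part that lowers the
  degree by 2 yields \<open>B (Suc i)\<close>.\<close>

lemma dickson_op_term:
  fixes a :: complex
  assumes "0 < n" and "i \<le> n div 2"
  defines "B \<equiv> \<lambda>i. monom (4 * of_nat n * of_nat i * of_nat ((n - i) choose i) * (- a) ^ i) (n - 2 * i)"
  shows "dickson_op n a
      (monom (of_nat n / of_nat (n - i) * of_nat ((n - i) choose i) * (- a) ^ i) (n - 2 * i))
    = B (Suc i) - B i"
proof -
  define N where "N = n - i - 1"
  define k where "k = n - 2 * i"
  have N: "n - i = Suc N" "n - Suc i = N" "i \<le> Suc N" "n = Suc N + i"
    and k: "Suc N - i = k" "N - i = k - 1" "n - 2 * Suc i = k - 2" "n = k + 2 * i"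
    using assms(1,2) by (auto simp: N_def k_def)
  \<comment> \<open>At k = 0 the natural \<open>k - 1\<close> is 0 while the complex one is -1; the
    factor k reconciles them.\<close>
  have nat_k: "of_nat (k * (k - 1)) = (of_nat k * (of_nat k - 1) :: complex)"
    by (cases k) (simp_all add: algebra_simps)
  have "of_nat (Suc i * Suc N * (N choose Suc i)) = (of_nat (k * (k - 1) * (Suc N choose i)) :: complex)"
    using choose_shift_both[OF N(3)] by (simp only: k)
  then have binom: "of_nat k * (of_nat k - 1) * of_nat (Suc N choose i) =
      (of_nat (Suc i) * of_nat (Suc N) * of_nat (N choose Suc i) :: complex)"
    by (simp only: of_nat_mult nat_k[symmetric])
  have nz: "of_nat (Suc N) \<noteq> (0 :: complex)" by (simp only: of_nat_eq_0_iff)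
  have "4 * a * (of_nat k * (of_nat k - 1)) * (of_nat n / of_nat (Suc N) * of_nat (Suc N choose i) * (- a) ^ i)
      = 4 * a * of_nat n / of_nat (Suc N) * (- a) ^ i
        * (of_nat k * (of_nat k - 1) * of_nat (Suc N choose i))"
    by (simp only: divide_inverse ac_simps)
  also have "\<dots> = - (4 * of_nat n * of_nat (Suc i) * of_nat (N choose Suc i) * (- a) ^ Suc i)"
    unfolding binom using nz by (simp del: of_nat_Suc add: field_simps)
  finally have low: "4 * a * (of_nat k * (of_nat k - 1)) * (of_nat n / of_nat (Suc N) * of_nat (Suc N choose i) * (- a) ^ i)
      = - (4 * of_nat n * of_nat (Suc i) * of_nat (N choose Suc i) * (- a) ^ Suc i)" .
  \<comment> \<open>Difference of squares: k - n = -2i and k + n = 2(n - i), so the factor n - i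
    cancels the denominator of the term.\<close>
  have "n = k + i + i" "Suc N = k + i" using N k by simp_all
  then have sq: "(of_nat k)\<^sup>2 - (of_nat n)\<^sup>2 = (- 4 * of_nat i * of_nat (Suc N) :: complex)"
    by (simp only: of_nat_add) (simp add: algebra_simps power2_eq_square)
  have high: "((of_nat k)\<^sup>2 - (of_nat n)\<^sup>2) * (of_nat n / of_nat (Suc N) * of_nat (Suc N choose i) * (- a) ^ i)
      = - (4 * of_nat n * of_nat i * of_nat (Suc N choose i) * (- a) ^ i)"
    unfolding sq using nz by (simp del: of_nat_Suc add: field_simps)
  show ?thesis
    unfolding B_def N(1,2) k(3) k_def[symmetric] dickson_op_monom low high
    by (simp only: minus_monom[symmetric]) simp
qed

lemma dickson_op_first: "dickson_op n a (dickson_first n a) = 0"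
proof (cases "n = 0")
  case True
  then show ?thesis by (simp add: dickson_op_def dickson_first_def pderiv_pCons)
next
  case False
  define B where
    "B i = monom (4 * of_nat n * of_nat i * of_nat ((n - i) choose i) * (- a) ^ i) (n - 2 * i)" for i
  have "dickson_op n a (dickson_first n a) = (\<Sum>i\<le>n div 2. B (Suc i) - B i)"
    unfolding dickson_first_def B_def using False
    by (simp only: if_False dickson_op_sum) (rule sum.cong[OF refl], rule dickson_op_term, auto)
  also have "\<dots> = B (Suc (n div 2)) - B 0"
    by (simp only: lessThan_Suc_atMost[symmetric] sum_lessThan_telescope)
  \<comment> \<open>Both ends of the telescope vanish: the upper one because its binomial
    coefficient is zero, \<open>B 0\<close> because of its factor i.\<close>
  also have "n - Suc (n div 2) < Suc (n div 2)" by linarith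
  then have "B (Suc (n div 2)) - B 0 = 0"
    by (simp add: B_def binomial_eq_0 del: binomial_Suc_Suc)
  finally show ?thesis .
qed

text \<open>The operator x d/dx multiplies the coefficient at x^(n-2i) by n - 2i, so n/(n-i) becomes
  n times (n-2i)/(n-i).\<close>

lemma dickson_third_eq_X_mult_pderiv:
  "smult (of_nat n) (dickson_third n a) = [:0, 1:] * pderiv (dickson_first n a)"
proof (cases "n = 0")
  case True
  then show ?thesis by (simp add: dickson_first_def pderiv_pCons)
next
  case False
  then show ?thesis
    by (simp only: dickson_first_def dickson_third_def if_False pderiv_sum smult_sum_right
        sum_distrib_left X_mult_pderiv_monom smult_monom times_divide_eq_left
        times_divide_eq_right ac_simps)
qed

theorem lemma1p1:
  fixes n :: nat and a u x :: complex
  assumes "a \<noteq> 0" and "u \<noteq> 0" and "u\<^sup>2 \<noteq> a" and "x = u + a * inverse u"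
  shows "(x\<^sup>2 - 4 * a) * poly (pderiv (pderiv (dickson_third n a))) x
           + 3 * x * poly (pderiv (dickson_third n a)) x
           - (of_nat n)\<^sup>2 * poly (dickson_third n a) x
         = 2 * of_nat n * poly (dickson_first n a) x"
proof (cases "n = 0")
  case True
  then show ?thesis by (simp add: dickson_third_def)
next
  case False
  define D where "D = dickson_first n a"
  define F where "F = dickson_third n a"
  define d0 d1 d2 d3 where "d0 = poly D x" and "d1 = poly (pderiv D) x"
    and "d2 = poly (pderiv (pderiv D)) x" and "d3 = poly (pderiv (pderiv (pderiv D))) x"
  note d_defs = d0_def d1_def d2_def d3_def
  define m :: complex where "m = of_nat n"
  have m: "m \<noteq> 0" using False by (simp add: m_def)
  have op: "dickson_op n a D = 0" by (simp add: D_def dickson_op_first)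
  have "poly (dickson_op n a D) x = 0" by (simp add: op)
  then have ode: "(x\<^sup>2 - 4 * a) * d2 + x * d1 = m\<^sup>2 * d0"
    by (simp add: dickson_op_def d_defs m_def algebra_simps power2_eq_square)
  \<comment> \<open>Differentiating the equation gives 3x d2: 2x from the leading coefficient and x
    from the first-order term.\<close>
  have "poly (pderiv (dickson_op n a D)) x = 0" by (simp add: op)
  then have ode': "(x\<^sup>2 - 4 * a) * d3 + 3 * x * d2 + d1 = m\<^sup>2 * d1"
    by (simp add: dickson_op_def d_defs m_def pderiv_add pderiv_diff pderiv_mult pderiv_smult
        pderiv_pCons algebra_simps power2_eq_square)
  have F: "smult m F = [:0, 1:] * pderiv D"
    by (simp add: F_def D_def m_def dickson_third_eq_X_mult_pderiv)
  have "poly (smult m F) x = x * d1"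
    by (simp add: F d_defs)
  then have f0: "m * poly F x = x * d1" by simp
  have "poly (pderiv (smult m F)) x = d1 + x * d2"
    unfolding F by (simp add: d_defs pderiv_mult pderiv_pCons)
  then have f1: "m * poly (pderiv F) x = d1 + x * d2" by (simp add: pderiv_smult)
  have "poly (pderiv (pderiv (smult m F))) x = 2 * d2 + x * d3"
    unfolding F by (simp add: d_defs pderiv_mult pderiv_pCons pderiv_add algebra_simps)
  then have f2: "m * poly (pderiv (pderiv F)) x = 2 * d2 + x * d3" by (simp add: pderiv_smult)
  have "m * ((x\<^sup>2 - 4 * a) * poly (pderiv (pderiv F)) x + 3 * x * poly (pderiv F) x - m\<^sup>2 * poly F x)
      = (x\<^sup>2 - 4 * a) * (m * poly (pderiv (pderiv F)) x) + 3 * x * (m * poly (pderiv F) x)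
        - m\<^sup>2 * (m * poly F x)"
    by (simp add: algebra_simps)
  \<comment> \<open>Regrouped as twice the left side of \<open>ode\<close> plus x times the
    difference of the two sides of \<open>ode'\<close>, which is zero.\<close>
  also have "\<dots> = 2 * ((x\<^sup>2 - 4 * a) * d2 + x * d1)
      + x * ((x\<^sup>2 - 4 * a) * d3 + 3 * x * d2 + d1 - m\<^sup>2 * d1)"
    unfolding f0 f1 f2 by (simp add: algebra_simps power2_eq_square)
  also have "\<dots> = m * (2 * m * d0)"
    unfolding ode ode' by (simp add: power2_eq_square)
  finally show ?thesis
    using m by (simp add: F_def D_def d0_def m_def)
qed

end
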